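(* Let $v_1<v_2<\cdots$ be a strictly increasing sequence of positive integers with counting function $N(n):=\#\{i\mid v_i\le n\}$, and suppose there are $\alpha\in(0,1]$, a real function $f$ on the positive integers, and constants $0<c_1\le c_2$ such that $c_1 n^{\alpha[1+f(n)]}\le N(n)\le c_2 n^{\alpha[1+f(n)]}$ for all sufficiently large $n$. Suppose that for sufficiently large $n$, $$\frac{n^{f(n)}}{(n+1)^{f(n+1)}}=1+\frac{\delta}{n}+O\!\left(\frac{1}{n^{p}}\right)$$ for some real $\delta$ and some $p>1$. Then $\sum_{i=1}^{\infty} v_i^{-x}<\infty$ for $x>\alpha(1-\delta)$ and $\sum_{i=1}^{\infty} v_i^{-x}=\infty$ for $x\le\alpha(1-\delta)$.
   Context: The paper writes the hypothesis on the counting function as "$N(n)\propto n^{\alpha[1+f(n)]}$", meaning equality up to bounded positive multiplicative constants, as made explicit in the claim. *)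

theory Defs
  imports Complex_Main "HOL-Library.Landau_Symbols"
begin

text \<open>Sequences are indexed by the positive integers; the value at index 0 is irrelevant.\<close>

definition counting_function :: "(nat \<Rightarrow> nat) \<Rightarrow> nat \<Rightarrow> nat" where
  "counting_function v n = card {i. 1 \<le> i \<and> v i \<le> n}"

end

theory Submission
  imports Defs "HOL-Analysis.Summation_Tests" "HOL-Real_Asymp.Real_Asymp"
begin

text \<open>
  Put \<open>g n = n powr f n\<close>. The hypothesis on the ratio says that \<open>h n = ln (g n * n powr \<delta>)\<close>
  has differences of order \<open>n powr - min p 2\<close>, which are summable; hence \<open>h\<close> converges and
  \<open>g n\<close> is comparable to \<open>n powr - \<delta>\<close>. So the counting function is comparable to
  \<open>n powr \<beta>\<close> with \<open>\<beta> = \<alpha> * (1 - \<delta>)\<close>. Evaluating it at \<open>v k\<close>, where it equals \<open>k\<close>,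
  makes \<open>k\<close> comparable to \<open>v k powr \<beta>\<close>; this forces \<open>\<beta> > 0\<close>, and the series compares
  with \<open>\<Sum> k powr - (x / \<beta>)\<close>.
\<close>

text \<open>Partial sums of nonnegative terms increase, and bounded ones would give summability.
  This turns mere failure of summability into the divergence to infinity that the theorem
  claims.\<close>

lemma filterlim_sum_at_top_of_not_summable:
  fixes a :: "nat \<Rightarrow> real"
  assumes nonneg: "\<And>n. 0 \<le> a n" and div: "\<not> summable a"
  shows "filterlim (\<lambda>n. \<Sum>k<n. a k) at_top sequentially"
  unfolding filterlim_at_top
proof
  fix Z :: real
  obtain M where M: "(\<Sum>k<M. a k) > Z"
    using div summableI_nonneg_bounded[of a Z] nonneg by (meson not_le)
  have "Z \<le> (\<Sum>k<n. a k)" if "n \<ge> M" for n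
    using M sum_mono2[of "{..<n}" "{..<M}" a] that nonneg by fastforce
  then show "\<forall>\<^sub>F n in sequentially. Z \<le> (\<Sum>k<n. a k)"
    unfolding eventually_sequentially by blast
qed

lemma convergent_if_summable_diff_Suc:
  fixes h :: "nat \<Rightarrow> real"
  assumes "summable (\<lambda>n. h n - h (Suc n))"
  shows "convergent h"
proof -
  have "convergent (\<lambda>n. \<Sum>k<n. h k - h (Suc k))"
    using assms summable_iff_convergent by blast
  then have "convergent (\<lambda>n. h 0 - h n)"
    by (simp only: sum_lessThan_telescope')
  then have "convergent (\<lambda>n. h 0 - (h 0 - h n))"
    by (rule convergent_diff[OF convergent_const])
  then show ?thesis
    by (simp only: diff_diff_eq2 add_diff_cancel_left')
qed

text \<open>Since \<open>w n\<close> tends to 1, \<open>ln (w n)\<close> is at most twice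
  \<open>w n - 1\<close> in absolute value for large \<open>n\<close>, so it inherits the summable
  order \<open>n powr - q\<close>.\<close>

lemma summable_ln_if_minus_one_bigo:
  fixes w :: "nat \<Rightarrow> real"
  assumes "(\<lambda>n. w n - 1) \<in> O(\<lambda>n. real n powr - q)" and q: "q > 1"
  shows "summable (\<lambda>n. ln (w n))"
proof -
  have "(\<lambda>n. real n powr - q) \<in> o(\<lambda>_. 1)"
    using q by real_asymp
  then have "((\<lambda>n. w n - 1) \<longlongrightarrow> 0) sequentially"
    using smalloD_tendsto[OF landau_o.big_small_trans[OF assms(1)]] by fastforce
  \<comment> \<open>The radius 1/2 is where the quadratic bound for \<open>ln (1 + x) - x\<close>
    applies; it also reduces that error \<open>2 * (w n - 1)^2\<close> to at most
    \<open>\<bar>w n - 1\<bar>\<close>.\<close>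
  then have ev: "\<forall>\<^sub>F n in sequentially. \<bar>w n - 1\<bar> < 1/2"
    by (auto dest!: tendstoD[where e = "1/2"] simp: dist_real_def)
  have "(\<lambda>n. ln (w n)) \<in> O(\<lambda>n. w n - 1)"
  proof (rule bigoI[where c = 2])
    show "\<forall>\<^sub>F n in sequentially. norm (ln (w n)) \<le> 2 * norm (w n - 1)"
      using ev
    proof eventually_elim
      case (elim n)
      have "\<bar>ln (1 + (w n - 1)) - (w n - 1)\<bar> \<le> 2 * (w n - 1)\<^sup>2"
        using elim by (intro abs_ln_one_plus_x_minus_x_bound) auto
      also have "\<dots> = 2 * (\<bar>w n - 1\<bar> * \<bar>w n - 1\<bar>)"
        by (simp add: power2_eq_square)
      also have "\<dots> \<le> 2 * (\<bar>w n - 1\<bar> * (1/2))"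
        using elim by (intro mult_left_mono) auto
      finally have "\<bar>ln (w n) - (w n - 1)\<bar> \<le> \<bar>w n - 1\<bar>" by simp
      then have "\<bar>ln (w n)\<bar> - \<bar>w n - 1\<bar> \<le> \<bar>w n - 1\<bar>"
        by (rule order_trans[OF abs_triangle_ineq2])
      then show ?case by (simp only: real_norm_def diff_le_eq mult_2)
    qed
  qed
  then have "(\<lambda>n. ln (w n)) \<in> O(\<lambda>n. real n powr - q)"
    using assms(1) landau_o.big_trans by blast
  moreover have "summable (\<lambda>n. norm (real n powr - q))"
    using q by (simp add: summable_real_powr_iff)
  ultimately show ?thesis
    by (rule summable_comparison_test_bigo[rotated])
qed

text \<open>In \<open>w\<close>, the factor \<open>(n / Suc n) powr \<delta>\<close> equals
  \<open>1 - \<delta> / n\<close> up to order \<open>n powr - 2\<close>, which cancels the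
  first-order term of the ratio and leaves a summable error.\<close>

lemma powr_asymptotics_of_ratio:
  fixes g :: "nat \<Rightarrow> real"
  assumes pos: "\<And>n. n > 0 \<Longrightarrow> g n > 0"
    and p: "p > 1"
    and ratio: "(\<lambda>n. g n / g (Suc n) - (1 + \<delta> / real n)) \<in> O(\<lambda>n. 1 / real n powr p)"
  shows "\<exists>C>0. \<forall>n>0. real n powr - \<delta> / C \<le> g n \<and> g n \<le> C * real n powr - \<delta>"
proof -
  \<comment> \<open>Two errors compete: order \<open>p\<close> from the hypothesis on the ratio, and
    order 2 from expanding \<open>(n / Suc n) powr \<delta>\<close>.\<close>
  define q where "q = min p 2"
  define h where "h n = ln (g n * real n powr \<delta>)" for n
  define w where "w n = g n / g (Suc n) * (real n / real (Suc n)) powr \<delta>" for n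
  have q: "q > 1" using p by (simp add: q_def)
  \<comment> \<open>With \<open>s = (n / Suc n) powr \<delta>\<close>, split \<open>w n - 1\<close>
    as \<open>(g n / g (Suc n) - (1 + \<delta> / n)) * s\<close> plus
    \<open>(1 + \<delta> / n) * s - 1\<close>. In the first summand \<open>s\<close> is
    bounded.\<close>
  have "(\<lambda>n. (g n / g (Suc n) - (1 + \<delta> / real n)) * (real n / real (Suc n)) powr \<delta>)
      \<in> O(\<lambda>n. 1 / real n powr p * 1)"
    by (rule landau_o.big.mult[OF ratio]) real_asymp
  moreover have "(\<lambda>n. 1 / real n powr p * 1) \<in> O(\<lambda>n. real n powr - q)"
  proof (rule bigoI[where c = 1])
    show "\<forall>\<^sub>F n in sequentially. norm (1 / real n powr p * 1) \<le> 1 * norm (real n powr - q)"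
      using eventually_gt_at_top[of 0]
    proof eventually_elim
      case (elim n)
      have "real n powr - p \<le> real n powr - q"
        using elim by (intro powr_mono) (auto simp: q_def)
      then show ?case by (simp add: powr_minus_divide)
    qed
  qed
  ultimately have 1: "(\<lambda>n. (g n / g (Suc n) - (1 + \<delta> / real n)) * (real n / real (Suc n)) powr \<delta>)
      \<in> O(\<lambda>n. real n powr - q)"
    using landau_o.big_trans by blast
  have "(\<lambda>n. (1 + \<delta> / real n) * (real n / real (Suc n)) powr \<delta> - 1) \<in> O(\<lambda>n. real n powr - 2)"
    by real_asymp
  moreover have "(\<lambda>n. real n powr - 2) \<in> O(\<lambda>n. real n powr - q)"
  proof (rule bigoI[where c = 1])
    show "\<forall>\<^sub>F n in sequentially. norm (real n powr - 2) \<le> 1 * norm (real n powr - q)"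
      using eventually_gt_at_top[of 0]
      by eventually_elim (auto intro!: powr_mono simp: q_def)
  qed
  ultimately have 2: "(\<lambda>n. (1 + \<delta> / real n) * (real n / real (Suc n)) powr \<delta> - 1)
      \<in> O(\<lambda>n. real n powr - q)"
    using landau_o.big_trans by blast
  have "(\<lambda>n. w n - 1) \<in> O(\<lambda>n. real n powr - q)"
    using sum_in_bigo(1)[OF 1 2] by (simp add: w_def algebra_simps)
  then have "summable (\<lambda>n. ln (w n))"
    using q by (rule summable_ln_if_minus_one_bigo)
  moreover have "\<forall>\<^sub>F n in sequentially. h n - h (Suc n) = ln (w n)"
    using eventually_gt_at_top[of 0]
  proof eventually_elim
    case (elim n)
    then show ?case
      using pos[of n] pos[of "Suc n"]
      by (simp add: h_def w_def ln_mult ln_div ln_powr powr_divide algebra_simps del: of_nat_Suc)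
  qed
  ultimately have "summable (\<lambda>n. h n - h (Suc n))"
    using summable_cong by fast
  \<comment> \<open>Only boundedness of the convergent \<open>h\<close> is used. It holds at every
    index, so \<open>C = exp B\<close> works for all \<open>n > 0\<close> and not just
    eventually.\<close>
  then have "Bseq h"
    using convergent_if_summable_diff_Suc convergent_imp_Bseq by blast
  then obtain B where B: "\<And>n. \<bar>h n\<bar> \<le> B"
    unfolding Bseq_def by auto
  have "real n powr - \<delta> / exp B \<le> g n \<and> g n \<le> exp B * real n powr - \<delta>" if "n > 0" for n
  proof -
    have "exp (h n) = g n * real n powr \<delta>"
      using pos[OF that] that by (simp add: h_def)
    then have "exp (- B) \<le> g n * real n powr \<delta>" "g n * real n powr \<delta> \<le> exp B"
      using B[of n] by (metis abs_le_iff exp_le_cancel_iff minus_le_iff)+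
    then show ?thesis
      using that by (simp add: powr_minus field_simps exp_minus)
  qed
  then show ?thesis by (intro exI[of _ "exp B"]) auto
qed

lemma strict_mono_on_atLeast_one_ge:
  fixes v :: "nat \<Rightarrow> nat"
  assumes "strict_mono_on {1..} v" and "v 1 > 0" and "k \<ge> 1"
  shows "k \<le> v k"
  using \<open>k \<ge> 1\<close>
proof (induction k rule: dec_induct)
  case (step k)
  have "v k < v (Suc k)"
    using assms(1) step.hyps by (auto simp: strict_mono_on_def)
  then show ?case using step by simp
qed (use assms in simp)

lemma counting_function_at_value:
  assumes "strict_mono_on {1..} v" and "k \<ge> 1"
  shows "counting_function v (v k) = k"
proof -
  have "{i. 1 \<le> i \<and> v i \<le> v k} = {1..k}"
    using assms by (auto simp: strict_mono_on_less_eq)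
  then show ?thesis by (simp add: counting_function_def)
qed

lemma powr_sum_dichotomy:
  fixes u :: "nat \<Rightarrow> real"
  assumes u: "\<And>i. u i \<ge> 1"
    and a: "a > 0" and b: "b > 0"
    and bounds: "\<forall>\<^sub>F i in sequentially. a * u i powr \<beta> \<le> real (Suc i) \<and> real (Suc i) \<le> b * u i powr \<beta>"
  shows "x > \<beta> \<Longrightarrow> summable (\<lambda>i. u i powr - x)"
    and "x \<le> \<beta> \<Longrightarrow> \<not> summable (\<lambda>i. u i powr - x)"
proof -
  \<comment> \<open>If \<open>\<beta> \<le> 0\<close>, then \<open>u i \<ge> 1\<close> keeps
    \<open>b * u i powr \<beta>\<close> below \<open>b\<close>, while it must dominate
    \<open>Suc i\<close>.\<close>
  have beta: "\<beta> > 0"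
  proof (rule ccontr)
    assume "\<not> \<beta> > 0"
    then have "u i powr \<beta> \<le> 1" for i
      using u[of i] powr_mono[of \<beta> 0 "u i"] by simp
    then have le: "b * u i powr \<beta> \<le> b" for i
      using b by (simp add: mult_left_le)
    have "\<forall>\<^sub>F i in sequentially. real i > b"
      by real_asymp
    with bounds have "\<forall>\<^sub>F i in sequentially. False"
    proof eventually_elim
      case (elim i)
      then show ?case using le[of i] by simp
    qed
    then show False by simp
  qed
  show "summable (\<lambda>i. u i powr - x)" if x: "x > \<beta>"
  proof -
    define t where "t = x / \<beta>"
    have t: "t > 1" using x beta by (simp add: t_def)
    have "summable (\<lambda>i. real (Suc i) powr - t)"
      using t summable_Suc_iff[of "\<lambda>i. real i powr - t"] by (simp add: summable_real_powr_iff)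
    then have sm: "summable (\<lambda>i. b powr t * real (Suc i) powr - t)"
      by (rule summable_mult)
    have ev: "\<forall>\<^sub>F i in sequentially. norm (u i powr - x) \<le> b powr t * real (Suc i) powr - t"
      using bounds
    proof eventually_elim
      case (elim i)
      have "u i powr - x = (u i powr \<beta>) powr - t"
        using beta by (simp add: powr_powr t_def)
      \<comment> \<open>A negative exponent reverses order, so the upper bound on
        \<open>Suc i\<close>, read as a lower bound on \<open>u i powr \<beta>\<close>, is the
        relevant one.\<close>
      also have "\<dots> \<le> (real (Suc i) / b) powr - t"
        using elim b t by (intro powr_mono2') (auto simp: field_simps)
      also have "\<dots> = b powr t * real (Suc i) powr - t"
        using b by (simp add: powr_divide powr_minus field_simps del: of_nat_Suc)
      finally show ?case by simp
    qed
    show ?thesis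
      by (rule summable_comparison_test_ev[OF ev sm])
  qed
  show "\<not> summable (\<lambda>i. u i powr - x)" if x: "x \<le> \<beta>"
  proof
    assume sm: "summable (\<lambda>i. u i powr - x)"
    \<comment> \<open>The borderline exponent suffices: the lower bound on \<open>Suc i\<close>
      compares \<open>u i powr - \<beta>\<close> with the harmonic series, and
      \<open>u i \<ge> 1\<close> makes the terms only larger for smaller \<open>x\<close>, whatever
      its sign.\<close>
    have ev: "\<forall>\<^sub>F i in sequentially. norm (a * inverse (real (Suc i))) \<le> u i powr - x"
      using bounds
    proof eventually_elim
      case (elim i)
      have "u i powr \<beta> > 0" using u[of i] by simp
      then have "a * inverse (real (Suc i)) \<le> u i powr - \<beta>"
        using elim by (simp add: powr_minus field_simps)
      also have "\<dots> \<le> u i powr - x"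
        using x u[of i] by (intro powr_mono) auto
      finally show ?case using a by simp
    qed
    have "summable (\<lambda>i. a * inverse (real (Suc i)))"
      by (rule summable_comparison_test_ev[OF ev sm])
    then have "summable (\<lambda>i. inverse (real (Suc i)))"
      using a by (simp add: summable_cmult_iff)
    then show False
      using not_summable_harmonic[where ?'a = real] summable_Suc_iff[of "\<lambda>i. inverse (real i)"] by simp
  qed
qed

theorem theorem5:
  fixes v :: "nat \<Rightarrow> nat" and f :: "nat \<Rightarrow> real"
    and \<alpha> c\<^sub>1 c\<^sub>2 \<delta> p :: real
  assumes v_pos: "\<And>i. i \<ge> 1 \<Longrightarrow> v i > 0"
    and v_strict_mono: "strict_mono_on {1..} v"
    and \<alpha>: "0 < \<alpha>" "\<alpha> \<le> 1"
    and c: "0 < c\<^sub>1" "c\<^sub>1 \<le> c\<^sub>2"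
    and N_bounds: "\<forall>\<^sub>F n in sequentially.
        c\<^sub>1 * real n powr (\<alpha> * (1 + f n)) \<le> real (counting_function v n) \<and>
        real (counting_function v n) \<le> c\<^sub>2 * real n powr (\<alpha> * (1 + f n))"
    and p: "p > 1"
    and ratio: "(\<lambda>n. real n powr f n / real (n + 1) powr f (n + 1) - (1 + \<delta> / real n))
        \<in> O(\<lambda>n. 1 / real n powr p)"
  shows "(\<forall>x::real. x > \<alpha> * (1 - \<delta>) \<longrightarrow> summable (\<lambda>i. real (v (Suc i)) powr (- x))) \<and>
    (\<forall>x::real. x \<le> \<alpha> * (1 - \<delta>) \<longrightarrow>
        filterlim (\<lambda>m. \<Sum>i=1..m. real (v i) powr (- x)) at_top sequentially)"
proof -
  define \<beta> where "\<beta> = \<alpha> * (1 - \<delta>)"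
  obtain C where C: "C > 0"
    and g: "\<And>n. n > 0 \<Longrightarrow> real n powr - \<delta> / C \<le> real n powr f n"
      "\<And>n. n > 0 \<Longrightarrow> real n powr f n \<le> C * real n powr - \<delta>"
    using powr_asymptotics_of_ratio[of "\<lambda>n. real n powr f n" p \<delta>] p ratio by auto
  \<comment> \<open>The exponent splits off \<open>n powr \<alpha>\<close>, and raising the bounds
    on \<open>n powr f n\<close> to the positive power \<open>\<alpha>\<close> turns
    \<open>C\<close> into \<open>C powr \<alpha>\<close>.\<close>
  have main_term: "real n powr \<beta> / C powr \<alpha> \<le> real n powr (\<alpha> * (1 + f n))"
      "real n powr (\<alpha> * (1 + f n)) \<le> C powr \<alpha> * real n powr \<beta>" if "n > 0" for n
  proof -
    have eq: "real n powr (\<alpha> * (1 + f n)) = real n powr \<alpha> * (real n powr f n) powr \<alpha>"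
      by (simp add: powr_powr powr_add algebra_simps)
    have eq': "real n powr \<beta> = real n powr \<alpha> * (real n powr - \<delta>) powr \<alpha>"
      by (simp add: powr_powr powr_add[symmetric] \<beta>_def algebra_simps)
    have "(real n powr - \<delta> / C) powr \<alpha> \<le> (real n powr f n) powr \<alpha>"
      using g[OF that] C \<alpha> by (intro powr_mono2) auto
    then show "real n powr \<beta> / C powr \<alpha> \<le> real n powr (\<alpha> * (1 + f n))"
      unfolding eq eq' using C by (simp add: powr_divide mult_left_mono flip: times_divide_eq_right)
    have "(real n powr f n) powr \<alpha> \<le> (C * real n powr - \<delta>) powr \<alpha>"
      using g[OF that] C \<alpha> by (intro powr_mono2) auto
    then show "real n powr (\<alpha> * (1 + f n)) \<le> C powr \<alpha> * real n powr \<beta>"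
      unfolding eq eq' using C by (simp add: powr_mult mult_left_mono flip: mult.left_commute[of "real n powr \<alpha>"])
  qed
  have v_ge: "Suc i \<le> v (Suc i)" for i
    using strict_mono_on_atLeast_one_ge[OF v_strict_mono] v_pos by simp
  \<comment> \<open>Bounds valid for large \<open>n\<close> can be pulled back along
    \<open>n = v (Suc i)\<close> because these values tend to infinity. The shift by one skips the
    meaningless \<open>v 0\<close>.\<close>
  have "filterlim (\<lambda>i. v (Suc i)) at_top sequentially"
    by (rule filterlim_at_top_mono[OF filterlim_Suc]) (use v_ge in simp)
  from eventually_compose_filterlim[OF N_bounds this]
  have bounds: "\<forall>\<^sub>F i in sequentially.
      c\<^sub>1 / C powr \<alpha> * real (v (Suc i)) powr \<beta> \<le> real (Suc i) \<and>
      real (Suc i) \<le> c\<^sub>2 * C powr \<alpha> * real (v (Suc i)) powr \<beta>"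
  proof eventually_elim
    case (elim i)
    let ?n = "v (Suc i)"
    have "?n > 0" using v_pos by simp
    note m = main_term[OF this]
    have N: "counting_function v ?n = Suc i"
      by (rule counting_function_at_value[OF v_strict_mono]) simp
    have "c\<^sub>1 * (real ?n powr \<beta> / C powr \<alpha>) \<le> c\<^sub>1 * real ?n powr (\<alpha> * (1 + f ?n))"
      "c\<^sub>2 * real ?n powr (\<alpha> * (1 + f ?n)) \<le> c\<^sub>2 * (C powr \<alpha> * real ?n powr \<beta>)"
      using c by (intro mult_left_mono m; simp)+
    with elim show ?case
      unfolding N by (simp add: mult.assoc)
  qed
  have u: "real (v (Suc i)) \<ge> 1" for i
    using v_pos[of "Suc i"] by simp
  have pos: "c\<^sub>1 / C powr \<alpha> > 0" "c\<^sub>2 * C powr \<alpha> > 0"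
    using c C by auto
  note dichotomy = powr_sum_dichotomy[OF u pos bounds]
  have "filterlim (\<lambda>m. \<Sum>i=1..m. real (v i) powr - x) at_top sequentially" if "x \<le> \<beta>" for x
  proof -
    have "filterlim (\<lambda>m. \<Sum>i<m. real (v (Suc i)) powr - x) at_top sequentially"
      by (rule filterlim_sum_at_top_of_not_summable[OF _ dichotomy(2)[OF that]]) simp
    then show ?thesis
      by (simp add: sum.atLeast1_atMost_eq)
  qed
  with dichotomy(1) show ?thesis
    by (auto simp: \<beta>_def)
qed

end
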